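(* For every integer $r\geq 3$, the number of $4\times 4$ involutory MDS matrices over the finite field $\mathbb{F}_{2^r}$ is at most $$2^r(2^r-1)^3(2^r-2)^2(2^r-3)(2^r-4).$$
   Context: A square matrix $M$ over a field is an MDS matrix if every square submatrix of $M$ (formed by any $i$ rows and any $i$ columns, $i\ge 1$, including $M$ itself) is nonsingular. A matrix $M$ of order $n$ is involutory if $M^2=I_n$. *)

theory Defs
  imports "HOL-Library.Cardinality" "Jordan_Normal_Form.Determinant" "Jordan_Normal_Form.DL_Submatrix"
begin

text \<open>Nonsingularity is expressed as having nonzero determinant. Every square submatrix is
  \<open>submatrix M I J\<close> for nonempty sets \<open>I\<close>, \<open>J\<close> of row and column indices (counted from \<open>0\<close>)
  of equal cardinality; \<open>submatrix\<close> lists the selected rows and columns in increasing order.\<close>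

definition mds_mat :: "'a::field mat \<Rightarrow> bool" where
  "mds_mat M \<longleftrightarrow> square_mat M \<and>
     (\<forall>I J. I \<subseteq> {..<dim_row M} \<longrightarrow> J \<subseteq> {..<dim_col M} \<longrightarrow> card I = card J \<longrightarrow> card I \<ge> 1 \<longrightarrow>
        det (submatrix M I J) \<noteq> 0)"

definition involutory_mat :: "'a::field mat \<Rightarrow> bool" where
  "involutory_mat M \<longleftrightarrow> square_mat M \<and> M * M = 1\<^sub>m (dim_row M)"

end

theory Submission
  imports Defs
begin

text \<open>The first two rows \<open>(a, p, s, t)\<close> and \<open>(c, d, x, y)\<close> of an involutory MDS matrix \<open>M\<close>
  determine it, because the minor \<open>s y - t x\<close> is nonzero and \<open>M\<^sup>2 = 1\<close> is then a linear system for
  the other two rows. Conjugating by a diagonal matrix, which contributes \<open>(q - 1)\<^sup>3\<close> for a field of size \<open>q\<close>, one may take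
  \<open>p = s = t = 1\<close>. The minors of the first two rows then force \<open>d, x, y\<close> to be distinct and nonzero,
  \<open>a \<noteq> 0\<close> and \<open>c \<notin> {0, a d, a x, a y}\<close>. The entry of \<open>M\<close> in the fourth row and third column is
  nonzero, which excludes one more value \<open>c = x (a - d + x)\<close>; it differs from the other
  four for all but three values of \<open>a\<close>. Hence there are at most
  \<open>(q - 1) (q - 5) + 3 = (q - 2) (q - 4)\<close> pairs \<open>(a, c)\<close> for each \<open>(d, x, y)\<close>.\<close>

section \<open>Entries and 2x2 minors as submatrix determinants\<close>

lemma
  assumes A: "A \<in> carrier_mat n m" and I: "I \<subseteq> {..<n}" and J: "J \<subseteq> {..<m}"
  shows submatrix_carrier: "submatrix A I J \<in> carrier_mat (card I) (card J)"
    and submatrix_index_subset: "i < card I \<Longrightarrow> j < card J \<Longrightarrow>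
      submatrix A I J $$ (i,j) = A $$ (pick I i, pick J j)"
proof -
  \<comment> \<open>\<open>submatrix\<close> filters its index sets by the dimensions; for sets
    within range the filter is vacuous.\<close>
  have "{i. i < dim_row A \<and> i \<in> I} = I" "{j. j < dim_col A \<and> j \<in> J} = J"
    using assms by auto
  then show "submatrix A I J \<in> carrier_mat (card I) (card J)"
      "i < card I \<Longrightarrow> j < card J \<Longrightarrow> submatrix A I J $$ (i,j) = A $$ (pick I i, pick J j)"
    unfolding submatrix_def by auto
qed

lemma mds_mat_entry_nonzero:
  assumes M: "M \<in> carrier_mat n n" "mds_mat M" and "i < n" "j < n"
  shows "M $$ (i,j) \<noteq> 0"
proof -
  have IJ: "{i} \<subseteq> {..<n}" "{j} \<subseteq> {..<n}"
    using assms by auto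
  have "det (submatrix M {i} {j}) \<noteq> 0"
    using assms unfolding mds_mat_def by auto
  moreover have "submatrix M {i} {j} \<in> carrier_mat 1 1"
    using submatrix_carrier[OF M(1) IJ] by simp
  moreover have "submatrix M {i} {j} $$ (0,0) = M $$ (i,j)"
  proof -
    have "pick {k} 0 = k" for k
      by (auto intro!: Least_equality)
    then show ?thesis
      by (simp add: submatrix_index_subset[OF M(1) IJ] del: pick.simps)
  qed
  ultimately show ?thesis
    by (simp add: det_single)
qed

lemma det_mat_2:
  fixes A :: "'a::comm_ring_1 mat"
  assumes A: "A \<in> carrier_mat 2 2"
  shows "det A = A $$ (0,0) * A $$ (1,1) - A $$ (0,1) * A $$ (1,0)"
proof -
  have "det (mat_delete A 0 j) = mat_delete A 0 j $$ (0,0)" for j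
    using mat_delete_carrier[OF A, of 0 j] by (intro det_single) simp
  then have "cofactor A 0 0 = A $$ (1,1)" "cofactor A 0 1 = - A $$ (1,0)"
    using A by (simp_all add: cofactor_def) (simp_all add: mat_delete_def)
  then show ?thesis
    by (simp add: laplace_expansion_row[OF A, of 0] numeral_2_eq_2 lessThan_Suc)
qed

lemma mds_mat_minor_nonzero:
  assumes M: "M \<in> carrier_mat n n" "mds_mat M" and "i < i'" "i' < n" "j < j'" "j' < n"
  shows "M $$ (i,j) * M $$ (i',j') - M $$ (i,j') * M $$ (i',j) \<noteq> 0"
proof -
  have IJ: "{i,i'} \<subseteq> {..<n}" "{j,j'} \<subseteq> {..<n}" and card: "card {i,i'} = 2" "card {j,j'} = 2"
    using assms by auto
  have P: "pick {k,k'} 0 = k" "pick {k,k'} (Suc 0) = k'" if "k < k'" for k k' :: nat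
  proof -
    show 0: "pick {k,k'} 0 = k"
      using that by (auto intro!: Least_equality)
    show "pick {k,k'} (Suc 0) = k'"
      using that 0 by (auto intro!: Least_equality)
  qed
  let ?S = "submatrix M {i,i'} {j,j'}"
  have "det ?S \<noteq> 0"
    using assms unfolding mds_mat_def by auto
  moreover have "?S \<in> carrier_mat 2 2"
    using submatrix_carrier[OF M(1) IJ] unfolding card .
  moreover have "?S $$ (0,0) = M $$ (i,j)" "?S $$ (0,1) = M $$ (i,j')"
      "?S $$ (1,0) = M $$ (i',j)" "?S $$ (1,1) = M $$ (i',j')"
    using assms(3,5) card by (simp_all add: submatrix_index_subset[OF M(1) IJ] P del: pick.simps)
  ultimately show ?thesis
    by (simp add: det_mat_2)
qed

section \<open>Recovering an involutory matrix from its first two rows\<close>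

lemma involutory_mat_row_eq:
  assumes "M \<in> carrier_mat 4 4" "involutory_mat M" "i < 4" "j < 4"
  shows "M $$ (i,0) * M $$ (0,j) + M $$ (i,1) * M $$ (1,j)
    + M $$ (i,2) * M $$ (2,j) + M $$ (i,3) * M $$ (3,j) = (if i = j then 1 else 0)"
proof -
  have "(M * M) $$ (i,j) = (if i = j then 1 else 0)"
    using assms unfolding involutory_mat_def by auto
  then show ?thesis
    using assms by (simp add: scalar_prod_def numeral_eq_Suc lessThan_Suc atLeast0LessThan ac_simps)
qed

text \<open>Cramer's rule without division: the determinant times each difference of unknowns is a
  combination of the differences of the equations.\<close>

lemma linear_system_2_unique:
  fixes s :: "'a::field"
  assumes "s * y - t * x \<noteq> 0" "s * u + t * v = s * u' + t * v'" "x * u + y * v = x * u' + y * v'"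
  shows "u = u'" "v = v'"
proof -
  have "(s * y - t * x) * (u - u')
      = y * ((s * u + t * v) - (s * u' + t * v')) - t * ((x * u + y * v) - (x * u' + y * v'))"
    by (simp add: algebra_simps)
  moreover have "(s * y - t * x) * (v - v')
      = s * ((x * u + y * v) - (x * u' + y * v')) - x * ((s * u + t * v) - (s * u' + t * v'))"
    by (simp add: algebra_simps)
  ultimately have "(s * y - t * x) * (u - u') = 0" "(s * y - t * x) * (v - v') = 0"
    unfolding assms(2,3) by simp_all
  with assms(1) show "u = u'" "v = v'"
    by auto
qed

lemma involutory_mds_mat_eqI:
  assumes M: "M \<in> carrier_mat 4 4" "involutory_mat M" "mds_mat M"
    and N: "N \<in> carrier_mat 4 4" "involutory_mat N"
    and eq: "\<And>i j. i < 2 \<Longrightarrow> j < 4 \<Longrightarrow> M $$ (i,j) = N $$ (i,j)"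
  shows "M = N"
proof (rule eq_matI)
  fix i j assume "i < dim_row N" "j < dim_col N"
  then have ij: "i < 4" "j < 4"
    using N by auto
  have minor: "M $$ (0,2) * M $$ (1,3) - M $$ (0,3) * M $$ (1,2) \<noteq> 0"
    using mds_mat_minor_nonzero[OF M(1,3), of 0 1 2 3] by simp
  \<comment> \<open>In row \<open>i\<close> of \<open>M * M = 1\<close> and \<open>N * N = 1\<close>
    the terms built from the shared rows 0 and 1 cancel. What remains for each column
    \<open>j\<close> is a 2x2 system for the entries in rows 2 and 3, with determinant
    \<open>minor\<close>.\<close>
  have "M $$ (i,2) * M $$ (2,j) + M $$ (i,3) * M $$ (3,j)
      = M $$ (i,2) * N $$ (2,j) + M $$ (i,3) * N $$ (3,j)" if "i < 2" for i
  proof -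
    have "i < 4"
      using that by simp
    from trans[OF involutory_mat_row_eq[OF M(1,2) this ij(2)]
        involutory_mat_row_eq[OF N this ij(2), symmetric]]
    show ?thesis
      using that ij(2) by (simp add: eq add.assoc)
  qed
  from linear_system_2_unique[OF minor this[of 0] this[of 1]]
  have "M $$ (2,j) = N $$ (2,j)" "M $$ (3,j) = N $$ (3,j)"
    by auto
  moreover have "i < 2 \<or> i = 2 \<or> i = 3"
    using ij by auto
  ultimately show "M $$ (i,j) = N $$ (i,j)"
    using eq ij by auto
qed (use M N in auto)

section \<open>Counting the normalized second rows\<close>

definition distinct_triples :: "('a::field \<times> 'a \<times> 'a) set" where
  "distinct_triples = (SIGMA d:UNIV - {0}. SIGMA x:UNIV - {0,d}. UNIV - {0,d,x})"

definition admissible_pairs :: "'a::field \<times> 'a \<times> 'a \<Rightarrow> ('a \<times> 'a) set" where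
  "admissible_pairs = (\<lambda>(d,x,y). SIGMA a:UNIV - {0}. UNIV - {0, a*d, a*x, a*y, x * (a - d + x)})"

lemma card_distinct_triples:
  "card (distinct_triples :: ('a::{field,finite} \<times> 'a \<times> 'a) set)
    = (CARD('a) - 1) * ((CARD('a) - 2) * (CARD('a) - 3))"
proof -
  have "card (SIGMA x:UNIV - {0,d}. UNIV - {0,d,x}) = (CARD('a) - 2) * (CARD('a) - 3)"
    if d: "d \<noteq> 0" for d :: 'a
  proof -
    have "card (UNIV - {0,d,x}) = CARD('a) - 3" if "x \<in> UNIV - {0,d}" for x
    proof -
      have "card {0,d,x} = 3"
        using d that by auto
      then show ?thesis
        by (simp only: card_Diff_subset finite subset_UNIV)
    qed
    moreover have "card {0,d} = 2"
      using d by simp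
    then have "card (UNIV - {0,d}) = CARD('a) - 2"
      by (simp only: card_Diff_subset finite subset_UNIV)
    ultimately show ?thesis
      by (simp add: card_SigmaI del: card_Diff_insert)
  qed
  then show ?thesis
    by (simp add: distinct_triples_def card_Diff_subset)
qed

lemma card_admissible_pairs:
  fixes d x y :: "'a::{field,finite}"
  assumes q: "CARD('a) \<ge> 5" and T: "(d,x,y) \<in> distinct_triples"
  shows "card (admissible_pairs (d,x,y)) \<le> (CARD('a) - 2) * (CARD('a) - 4)"
proof -
  let ?q = "CARD('a)"
  \<comment> \<open>The values of \<open>a\<close> at which \<open>x * (a - d + x)\<close> equals
    \<open>0\<close>, \<open>a*d\<close> and \<open>a*y\<close> respectively. Equality with
    \<open>a*x\<close> would force \<open>x = d\<close>.\<close>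
  define B where "B = {d - x, - x, x * (d - x) / (x - y)}"
  define F where "F a = {0, a*d, a*x, a*y, x * (a - d + x)}" for a
  have nz: "d \<noteq> 0" "x \<noteq> 0" "y \<noteq> 0" "d \<noteq> x" "d \<noteq> y" "x \<noteq> y"
    using T by (auto simp: distinct_triples_def)
  have fibre: "card (UNIV - F a) \<le> ?q - 5 + (if a \<in> B then 1 else 0)" if a: "a \<noteq> 0" for a
  proof -
    have 4: "card {0, a*d, a*x, a*y} = 4"
      using a nz by auto
    show ?thesis
    proof (cases "a \<in> B")
      case True
      \<comment> \<open>Four excluded values are certain even here, so at most q - 4 = (q - 5) + 1
        choices remain, where q is the field size.\<close>
      have "card {0, a*d, a*x, a*y} \<le> card (F a)"
        by (rule card_mono) (auto simp: F_def)
      with 4 True q show ?thesis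
        by (simp add: card_Diff_subset)
    next
      case False
      have "a - d + x = a - (d - x)"
        by simp
      then have "a - d + x \<noteq> 0"
        using False unfolding B_def by (metis insertI1 right_minus_eq)
      then have "x * (a - d + x) \<noteq> 0"
        using nz by simp
      moreover have "x * (a - d + x) - a * x = x * (x - d)"
        by (simp add: algebra_simps)
      then have "x * (a - d + x) \<noteq> a * x"
        using nz by auto
      moreover have "x * (a - d + x) - a * d = (a + x) * (x - d)"
        by (simp add: algebra_simps)
      then have "x * (a - d + x) \<noteq> a * d"
        using False nz by (auto simp: B_def eq_neg_iff_add_eq_0)
      moreover have "x * (a - d + x) - a * y = a * (x - y) - x * (d - x)"
        by (simp add: algebra_simps)
      then have "x * (a - d + x) \<noteq> a * y"
        using False nz by (auto simp: B_def eq_divide_eq)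
      moreover have "F a = insert (x * (a - d + x)) {0, a*d, a*x, a*y}"
        by (auto simp: F_def)
      ultimately have "card (F a) = 5"
        using 4 by simp
      with False show ?thesis
        by (simp add: card_Diff_subset)
    qed
  qed
  have "card (admissible_pairs (d,x,y)) = (\<Sum>a\<in>UNIV - {0}. card (UNIV - F a))"
    by (simp add: admissible_pairs_def F_def card_SigmaI)
  also have "\<dots> \<le> (\<Sum>a\<in>UNIV - {0}. ?q - 5 + (if a \<in> B then 1 else 0))"
    by (intro sum_mono fibre) auto
  also have "\<dots> = (?q - 1) * (?q - 5) + card ((UNIV - {0}) \<inter> B)"
    by (simp add: sum.distrib card_Diff_subset sum.If_cases)
  also have "card ((UNIV - {0}) \<inter> B) \<le> card B"
    by (rule card_mono) auto
  also have "card B \<le> 3"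
    unfolding B_def by (simp add: card_insert_if)
  also have "(?q - 1) * (?q - 5) + 3 = (?q - 2) * (?q - 4)"
  proof -
    obtain k where "?q = k + 5"
      using q by (metis add.commute le_Suc_ex)
    then show ?thesis
      by (simp add: algebra_simps)
  qed
  finally show ?thesis
    by simp
qed

text \<open>The invariants below are the entries in the first two rows of \<open>D M D\<^sup>-\<^sup>1\<close> for
  \<open>D = diag(1, p, s, t)\<close>, whose first row is \<open>(a, 1, 1, 1)\<close>.\<close>

definition row_code :: "'a::field mat \<Rightarrow> ('a \<times> 'a \<times> 'a) \<times> ('a \<times> 'a \<times> 'a) \<times> 'a \<times> 'a" where
  "row_code M = (let p = M $$ (0,1); s = M $$ (0,2); t = M $$ (0,3) in
     ((p, s, t), (M $$ (1,1), p * M $$ (1,2) / s, p * M $$ (1,3) / t), M $$ (0,0), p * M $$ (1,0)))"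

lemma row_code_mem:
  assumes M: "M \<in> carrier_mat 4 4" "involutory_mat M" "mds_mat M"
  shows "row_code M \<in> ((UNIV - {0}) \<times> (UNIV - {0}) \<times> (UNIV - {0}))
    \<times> (SIGMA T:distinct_triples. admissible_pairs T)"
proof -
  define a p s t c d x y where
    defs: "a = M $$ (0,0)" "p = M $$ (0,1)" "s = M $$ (0,2)" "t = M $$ (0,3)"
      "c = M $$ (1,0)" "d = M $$ (1,1)" "x = M $$ (1,2)" "y = M $$ (1,3)"
  have nz: "a \<noteq> 0" "p \<noteq> 0" "s \<noteq> 0" "t \<noteq> 0" "c \<noteq> 0" "d \<noteq> 0" "x \<noteq> 0" "y \<noteq> 0" "M $$ (3,2) \<noteq> 0"
    unfolding defs by (intro mds_mat_entry_nonzero[OF M(1,3)]; simp)+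
  note minor = mds_mat_minor_nonzero[OF M(1,3), of 0 1]
  have m: "a * d - p * c \<noteq> 0" "a * x - s * c \<noteq> 0" "a * y - t * c \<noteq> 0"
      "p * x - s * d \<noteq> 0" "p * y - t * d \<noteq> 0" "s * y - t * x \<noteq> 0"
    unfolding defs using minor[of 0 1] minor[of 0 2] minor[of 0 3] minor[of 1 2] minor[of 1 3]
      minor[of 2 3] by simp_all
  have e: "a * s + p * x + s * M $$ (2,2) + t * M $$ (3,2) = 0"
      "c * s + d * x + x * M $$ (2,2) + y * M $$ (3,2) = 0"
    using involutory_mat_row_eq[OF M(1,2), of 0 2] involutory_mat_row_eq[OF M(1,2), of 1 2]
    unfolding defs by simp_all
  \<comment> \<open>Eliminating \<open>M $$ (2,2)\<close>: \<open>s\<close> times the second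
    equation of \<open>e\<close> minus \<open>x\<close> times the first leaves
    \<open>M $$ (3,2)\<close> times a minor of the first two rows.\<close>
  have "s^2 * c - x * (a * s - d * s + p * x) = M $$ (3,2) * (t * x - s * y)
      + s * (c * s + d * x + x * M $$ (2,2) + y * M $$ (3,2))
      - x * (a * s + p * x + s * M $$ (2,2) + t * M $$ (3,2))"
    by (simp add: algebra_simps power2_eq_square)
  then have "s^2 * c - x * (a * s - d * s + p * x) = M $$ (3,2) * (t * x - s * y)"
    unfolding e by simp
  then have k: "s^2 * c \<noteq> x * (a * s - d * s + p * x)"
    using nz m by auto
  \<comment> \<open>\<open>k\<close> multiplied by \<open>p\<close>, rewritten for the normalized
    entries \<open>p * c\<close> and \<open>p * x / s\<close>.\<close>
  have "s^2 * (p * x / s * (a - d + p * x / s)) = p * (x * (a * s - d * s + p * x))"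
    using nz by (simp add: field_simps power2_eq_square)
  then have "p * c \<noteq> p * x / s * (a - d + p * x / s)"
    using nz k by (metis mult.left_commute mult_left_cancel)
  \<comment> \<open>Clearing the denominators \<open>s\<close> and \<open>t\<close> turns these into
    the six minors in \<open>m\<close>.\<close>
  moreover have "p * x / s \<noteq> d" "p * y / t \<noteq> d" "p * y / t \<noteq> p * x / s"
      "p * c \<noteq> a * d" "p * c \<noteq> a * (p * x / s)" "p * c \<noteq> a * (p * y / t)"
    using nz m by (auto simp: field_simps)
  ultimately show ?thesis
    unfolding row_code_def distinct_triples_def admissible_pairs_def Let_def defs[symmetric]
    using nz by auto
qed

text \<open>The code records the nonzero scaling factors, so the normalization can be undone and the
  first two rows recovered.\<close>

lemma inj_on_row_code:
  "inj_on row_code {M. M \<in> carrier_mat 4 4 \<and> involutory_mat M \<and> mds_mat M}"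
proof (rule inj_onI, clarify)
  fix M N :: "'a mat"
  assume M: "M \<in> carrier_mat 4 4" "involutory_mat M" "mds_mat M"
    and N: "N \<in> carrier_mat 4 4" "involutory_mat N" "mds_mat N"
    and eq: "row_code M = row_code N"
  have nz: "N $$ (0,1) \<noteq> 0" "N $$ (0,2) \<noteq> 0" "N $$ (0,3) \<noteq> 0"
    by (intro mds_mat_entry_nonzero[OF N(1,3)]; simp)+
  show "M = N"
  proof (rule involutory_mds_mat_eqI[OF M N(1,2)])
    fix i j :: nat assume "i < 2" "j < 4"
    then have "i = 0 \<or> i = 1" "j = 0 \<or> j = 1 \<or> j = 2 \<or> j = 3"
      by auto
    then show "M $$ (i,j) = N $$ (i,j)"
      using eq nz by (auto simp: row_code_def Let_def)
  qed
qed

theorem proposition2: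
  fixes r :: nat
  assumes "r \<ge> 3"
    and "CARD('a) = 2 ^ r"
  shows "card {M :: 'a::{field,finite} mat. M \<in> carrier_mat 4 4 \<and> involutory_mat M \<and> mds_mat M}
    \<le> 2 ^ r * (2 ^ r - 1) ^ 3 * (2 ^ r - 2) ^ 2 * (2 ^ r - 3) * (2 ^ r - 4)"
proof -
  let ?q = "CARD('a)"
  let ?U = "UNIV - {0::'a}"
  let ?P = "SIGMA T:distinct_triples. admissible_pairs (T :: 'a \<times> 'a \<times> 'a)"
  have "(2::nat) ^ 3 \<le> 2 ^ r"
    using assms(1) by (intro power_increasing) auto
  then have q: "?q \<ge> 5"
    using assms(2) by simp
  have "card {M :: 'a mat. M \<in> carrier_mat 4 4 \<and> involutory_mat M \<and> mds_mat M}
      \<le> card ((?U \<times> ?U \<times> ?U) \<times> ?P)"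
  proof (rule card_inj_on_le[OF inj_on_row_code])
    show "row_code ` {M :: 'a mat. M \<in> carrier_mat 4 4 \<and> involutory_mat M \<and> mds_mat M}
        \<subseteq> (?U \<times> ?U \<times> ?U) \<times> ?P"
      by (rule image_subsetI, rule row_code_mem) simp_all
  qed (rule finite)
  also have "\<dots> = (?q - 1) ^ 3 * (\<Sum>T\<in>distinct_triples. card (admissible_pairs (T :: 'a \<times> 'a \<times> 'a)))"
    by (simp add: card_cartesian_product card_Diff_subset card_SigmaI power3_eq_cube)
  also have "\<dots> \<le> (?q - 1) ^ 3 * (\<Sum>T\<in>(distinct_triples :: ('a \<times> 'a \<times> 'a) set). (?q - 2) * (?q - 4))"
    using card_admissible_pairs[OF q] by (intro mult_left_mono sum_mono) auto
  also have "\<dots> = (?q - 1) * ((?q - 1) ^ 3 * (?q - 2) ^ 2 * (?q - 3) * (?q - 4))"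
    by (simp add: card_distinct_triples power2_eq_square)
  \<comment> \<open>The count contains the fourth power of \<open>?q - 1\<close>; weakening one of
    these factors to \<open>?q\<close> gives the stated form.\<close>
  also have "\<dots> \<le> ?q * ((?q - 1) ^ 3 * (?q - 2) ^ 2 * (?q - 3) * (?q - 4))"
    by (intro mult_right_mono) auto
  finally show ?thesis
    by (simp add: assms(2) mult.assoc)
qed

end
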